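(* Let $\omega$ be a finite sequence of numbers and $k\ge1$ an integer. Let $|\mathsf{OPT}|$ be the optimal value of the $k$-LIS problem on $\omega$, and let $g_k=|A_1|+\cdots+|A_k|$ be the total length of the subsequences $A_1,\dots,A_k$ produced by the greedy algorithm. Then $$\frac{g_k}{|\mathsf{OPT}|}\ge 1-\Big(\frac{k-1}{k}\Big)^k>1-\frac1e.$$
   Context: The $k$-LIS problem: given a sequence $\omega$, find $k$ pairwise disjoint (position-disjoint) increasing subsequences of $\omega$ maximizing their total length; $|\mathsf{OPT}|$ is this maximum total length (assumed positive, i.e. $\omega$ nonempty). The greedy algorithm: for $i=1,\dots,k$, choose a longest increasing subsequence $A_i$ of the current sequence (any one if several), output it, and remove its elements from the sequence. *)

theory Defs
  imports Complex_Main "HOL-Library.Disjoint_Sets"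
begin

text \<open>A subsequence of a sequence is represented by its set of positions, so that equal values at
  different positions remain distinct; its length is the cardinality of that set.
  ``Increasing'' means strictly increasing.\<close>

definition increasing_subseq :: "real list \<Rightarrow> nat set \<Rightarrow> bool" where
  "increasing_subseq w S \<longleftrightarrow> S \<subseteq> {..<length w} \<and> strict_mono_on S (\<lambda>i. w ! i)"

text \<open>Some of the \<open>k\<close> subsequences may be empty; otherwise nothing would be feasible for
  \<open>k > length w\<close>.\<close>

definition klis_feasible :: "real list \<Rightarrow> nat \<Rightarrow> (nat \<Rightarrow> nat set) \<Rightarrow> bool" where
  "klis_feasible w k B \<longleftrightarrow>
     (\<forall>i<k. increasing_subseq w (B i)) \<and> disjoint_family_on B {..<k}"

definition klis_opt :: "real list \<Rightarrow> nat \<Rightarrow> nat" where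
  "klis_opt w k = Max {\<Sum>i<k. card (B i) | B. klis_feasible w k B}"

text \<open>The maximum in \<open>klis_opt\<close> is over a finite nonempty set.\<close>

lemma finite_klis_values: "finite {\<Sum>i<k. card (B i) | B. klis_feasible w k B}"
proof (rule finite_subset)
  show "{\<Sum>i<k. card (B i) | B. klis_feasible w k B} \<subseteq> {..k * length w}"
  proof
    fix n assume "n \<in> {\<Sum>i<k. card (B i) | B. klis_feasible w k B}"
    then obtain B where B: "klis_feasible w k B" and n: "n = (\<Sum>i<k. card (B i))" by blast
    have "card (B i) \<le> length w" if "i < k" for i
    proof -
      have "B i \<subseteq> {..<length w}"
        using B that by (auto simp: klis_feasible_def increasing_subseq_def)
      then show ?thesis using card_mono[of "{..<length w}" "B i"] by simp
    qed
    then have "n \<le> (\<Sum>i<k. length w)" unfolding n by (intro sum_mono) simp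
    then show "n \<in> {..k * length w}" by simp
  qed
qed simp

lemma klis_values_nonempty: "{\<Sum>i<k. card (B i) | B. klis_feasible w k B} \<noteq> {}"
proof -
  have "klis_feasible w k (\<lambda>_. {})"
    by (auto simp: klis_feasible_def increasing_subseq_def disjoint_family_on_def strict_mono_on_def)
  then show ?thesis by blast
qed

text \<open>\<open>S\<close> is a longest increasing subsequence of what is left of \<open>w\<close> when only the positions in
  \<open>R\<close> remain.\<close>

definition is_lis_within :: "real list \<Rightarrow> nat set \<Rightarrow> nat set \<Rightarrow> bool" where
  "is_lis_within w R S \<longleftrightarrow>
     increasing_subseq w S \<and> S \<subseteq> R \<and>
     (\<forall>T. increasing_subseq w T \<and> T \<subseteq> R \<longrightarrow> card T \<le> card S)"

text \<open>\<open>A 0, \<dots>, A (k - 1)\<close> is a possible output of the greedy algorithm, with ties broken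
  arbitrarily.\<close>

definition greedy_run :: "real list \<Rightarrow> nat \<Rightarrow> (nat \<Rightarrow> nat set) \<Rightarrow> bool" where
  "greedy_run w k A \<longleftrightarrow>
     (\<forall>i<k. is_lis_within w ({..<length w} - (\<Union>j<i. A j)) (A i))"

end

theory Submission
  imports Defs
begin

text \<open>Let \<open>g\<^sub>i\<close> be the number of elements removed before round \<open>i\<close>. These hit at most \<open>g\<^sub>i\<close> elements
  of an optimal family of \<open>k\<close> disjoint increasing subsequences, so what remains of that family has
  total length at least \<open>OPT - g\<^sub>i\<close>, and the greedy choice is at least the average
  \<open>(OPT - g\<^sub>i) / k\<close>. Hence the deficit \<open>OPT - g\<^sub>i\<close> shrinks by a factor \<open>1 - 1 / k\<close> in each round.\<close>

lemma increasing_subseq_subset: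
  "increasing_subseq w S \<Longrightarrow> T \<subseteq> S \<Longrightarrow> increasing_subseq w T"
  unfolding increasing_subseq_def by (auto simp: strict_mono_on_def subset_iff)

lemma increasing_subseq_finite: "increasing_subseq w S \<Longrightarrow> finite S"
  unfolding increasing_subseq_def by (auto intro: finite_subset)

lemma klis_opt_attained:
  obtains B where "klis_feasible w k B" "klis_opt w k = (\<Sum>i<k. card (B i))"
  using Max_in[OF finite_klis_values[where w = w and k = k] klis_values_nonempty]
  unfolding klis_opt_def by blast

text \<open>Allows the final bound to be divided by the optimum. The witness is the single position
  0 as one subsequence, with all others empty.\<close>

lemma klis_opt_pos:
  assumes "w \<noteq> []" and "k \<ge> 1"
  shows "klis_opt w k > 0"
proof -
  define B where "B = (\<lambda>i::nat. if i = 0 then {0::nat} else {})"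
  have "klis_feasible w k B"
    using assms(1)
    by (auto simp: klis_feasible_def increasing_subseq_def disjoint_family_on_def
        strict_mono_on_def B_def)
  then have "(\<Sum>i<k. card (B i)) \<le> klis_opt w k"
    unfolding klis_opt_def by (intro Max_ge[OF finite_klis_values]) blast
  moreover have "card (B 0) \<le> (\<Sum>i<k. card (B i))"
    using assms(2) by (intro member_le_sum) auto
  ultimately show ?thesis by (simp add: B_def)
qed

text \<open>The averaging bound, arranged without subtraction or division so that it stays within
  \<open>nat\<close>.\<close>

lemma greedy_step:
  assumes run: "greedy_run w k A" and "i < k"
  shows "klis_opt w k \<le> (\<Sum>j<i. card (A j)) + k * card (A i)"
proof -
  obtain B where B: "klis_feasible w k B" and opt: "klis_opt w k = (\<Sum>l<k. card (B l))"
    by (rule klis_opt_attained)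
  define U where "U = (\<Union>j<i. A j)"
  have lis: "is_lis_within w ({..<length w} - (\<Union>n<j. A n)) (A j)" if "j < k" for j
    using run that by (simp add: greedy_run_def)
  have incB: "increasing_subseq w (B l)" if "l < k" for l
    using B that by (simp add: klis_feasible_def)
  have finU: "finite U"
    using lis \<open>i < k\<close> by (auto simp: U_def is_lis_within_def intro!: increasing_subseq_finite[of w])
  \<comment> \<open>What remains of \<open>B l\<close> is still available in round \<open>i\<close>,
    so it competes with \<open>A i\<close>.\<close>
  have le: "card (B l - U) \<le> card (A i)" if "l < k" for l
  proof -
    have "increasing_subseq w (B l - U)"
      using incB[OF that] by (rule increasing_subseq_subset) simp
    moreover from this have "B l - U \<subseteq> {..<length w} - U"
      by (auto simp: increasing_subseq_def)
    ultimately show ?thesis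
      using lis[OF \<open>i < k\<close>] by (simp add: is_lis_within_def U_def)
  qed
  \<comment> \<open>Since the \<open>B l\<close> are disjoint, each removed position is charged to
    at most one of them.\<close>
  have "(\<Sum>l<k. card (B l \<inter> U)) = card (\<Union>l<k. B l \<inter> U)"
    using B finU
    by (intro card_UN_disjoint[symmetric]) (auto simp: klis_feasible_def disjoint_family_on_def)
  also have "\<dots> \<le> card U"
    by (intro card_mono finU) auto
  also have "\<dots> \<le> (\<Sum>j<i. card (A j))"
    unfolding U_def by (rule card_UN_le) simp
  finally have hit: "(\<Sum>l<k. card (B l \<inter> U)) \<le> (\<Sum>j<i. card (A j))" .
  have "klis_opt w k = (\<Sum>l<k. card (B l \<inter> U) + card (B l - U))"
    unfolding opt using incB
    by (intro sum.cong card_Int_Diff increasing_subseq_finite) auto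
  also have "\<dots> = (\<Sum>l<k. card (B l \<inter> U)) + (\<Sum>l<k. card (B l - U))"
    by (rule sum.distrib)
  also have "(\<Sum>l<k. card (B l - U)) \<le> k * card (A i)"
    using sum_bounded_above[of "{..<k}" "\<lambda>l. card (B l - U)" "card (A i)"] le by simp
  finally show ?thesis using hit by linarith
qed

lemma greedy_deficit:
  assumes run: "greedy_run w k A" and "i \<le> k"
  shows "real (klis_opt w k) - real (\<Sum>j<i. card (A j))
    \<le> ((real k - 1) / real k) ^ i * real (klis_opt w k)"
  using \<open>i \<le> k\<close>
proof (induction i)
  case 0
  show ?case by simp
next
  case (Suc i)
  let ?O = "real (klis_opt w k)" and ?g = "real (\<Sum>j<i. card (A j))" and ?a = "real (card (A i))"
  have k: "real k \<ge> 1" using Suc.prems by simp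
  have "?O \<le> ?g + real k * ?a"
    using greedy_step[OF run, of i] Suc.prems
    by (metis Suc_le_eq of_nat_add of_nat_le_iff of_nat_mult)
  \<comment> \<open>Round \<open>i\<close> removes at least the fraction \<open>1 / k\<close> of the
    current deficit \<open>?O - ?g\<close>.\<close>
  then have "?O - (?g + ?a) \<le> (real k - 1) / real k * (?O - ?g)"
    using k by (simp add: field_simps)
  also have "\<dots> \<le> (real k - 1) / real k * (((real k - 1) / real k) ^ i * ?O)"
    using Suc k by (intro mult_left_mono) auto
  finally show ?case by (simp add: mult.assoc)
qed

lemma one_minus_inverse_power_less:
  assumes "k \<ge> 1"
  shows "((real k - 1) / real k) ^ k < 1 / exp 1"
proof -
  \<comment> \<open>This is \<open>1 - x < exp (- x)\<close> at \<open>x = 1 / k\<close>, strict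
    because \<open>x\<close> is nonzero. The left side is nonnegative, so \<open>k\<close>-th powers
    preserve the strict inequality.\<close>
  have "(real k - 1) / real k < exp (- 1 / real k)"
    using exp_minus_greater[of "1 / real k"] assms by (simp add: field_simps)
  then have "((real k - 1) / real k) ^ k < exp (- 1 / real k) ^ k"
    using assms by (intro power_strict_mono) auto
  also have "\<dots> = 1 / exp 1"
    using assms by (simp flip: exp_of_nat_mult) (simp add: exp_minus inverse_eq_divide)
  finally show ?thesis .
qed

theorem theorem3p2:
  fixes w :: "real list" and k :: nat and A :: "nat \<Rightarrow> nat set"
  assumes "w \<noteq> []" and "k \<ge> 1" and "greedy_run w k A"
  shows "real (\<Sum>i<k. card (A i)) / real (klis_opt w k) \<ge> 1 - ((real k - 1) / real k) ^ k
       \<and> 1 - ((real k - 1) / real k) ^ k > 1 - 1 / exp (1 :: real)"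
proof
  show "real (\<Sum>i<k. card (A i)) / real (klis_opt w k) \<ge> 1 - ((real k - 1) / real k) ^ k"
    \<comment> \<open>The deficit bound after all \<open>k\<close> rounds, divided by the positive
      optimum.\<close>
    using greedy_deficit[OF assms(3) order_refl] klis_opt_pos[OF assms(1,2)]
    by (simp add: pos_le_divide_eq left_diff_distrib)
  show "1 - ((real k - 1) / real k) ^ k > 1 - 1 / exp (1 :: real)"
    using one_minus_inverse_power_less[OF assms(2)] by simp
qed

end
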